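(* Let $1\le p\le\infty$, let $\ell_p^+$ be the natural positive cone of $X=\ell_p$ (sequences with all coordinates $\ge0$), and let $u\in(\ell_p^+)_N$. Then $(X_u,\|\cdot\|_u)$ is linearly isometric to $\ell_\infty$.
   Context: Real scalars. For a closed convex set $C\subset X$, $C_N$ denotes the set of points $x\in C$ that are not support points, where $x\in C$ is a support point if there is a nonzero $x^*\in X^*$ with $\langle x^*,x\rangle=\max\{\langle x^*,y\rangle:y\in C\}$. With $C=\ell_p^+$ and the coordinatewise order, $[-u,u]=\{x\in X:-u\le x\le u\}$, $X_u=C_u\cap(-C_u)$ with $C_u=\bigcup_{\lambda>0}\lambda(C-u)$ (equivalently $X_u=\bigcup_{\lambda>0}\lambda[-u,u]$), and $\|x\|_u=\inf\{\lambda>0:x\in\lambda[-u,u]\}$. *)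

theory Defs
  imports "HOL-Analysis.Analysis" "HOL-Library.Function_Algebras"
begin

text \<open>The order \<^term>\<open>x \<le> y\<close> on sequences is already the coordinatewise one, and
  sums, differences and negatives are pointwise; only the scalar multiplication is missing.\<close>

instantiation "fun" :: (type, scaleR) scaleR
begin

definition scaleR_fun_def: "c *\<^sub>R f = (\<lambda>i. c *\<^sub>R f i)"

instance ..

end

lemma scaleR_fun_apply [simp]: "(c *\<^sub>R f) i = c *\<^sub>R f i"
  by (simp add: scaleR_fun_def)

instance "fun" :: (type, real_vector) real_vector
  by standard (simp_all add: fun_eq_iff scaleR_add_right scaleR_add_left)

text \<open>A normed space is given by a carrier \<open>V\<close> inside a real vector space together with
  a norm \<open>N\<close> on \<open>V\<close>. Maps are HOL functions on the whole ambient type, of which only the values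
  on the carrier matter.\<close>

definition linear_on :: "'a::real_vector set \<Rightarrow> ('a \<Rightarrow> 'b::real_vector) \<Rightarrow> bool" where
  "linear_on V f \<longleftrightarrow>
     (\<forall>x\<in>V. \<forall>y\<in>V. f (x + y) = f x + f y) \<and> (\<forall>c. \<forall>x\<in>V. f (c *\<^sub>R x) = c *\<^sub>R f x)"

definition dual_space :: "'a::real_vector set \<Rightarrow> ('a \<Rightarrow> real) \<Rightarrow> ('a \<Rightarrow> real) set" where
  "dual_space V N = {f. linear_on V f \<and> (\<exists>B. \<forall>x\<in>V. \<bar>f x\<bar> \<le> B * N x)}"

definition support_point ::
    "'a::real_vector set \<Rightarrow> ('a \<Rightarrow> real) \<Rightarrow> 'a set \<Rightarrow> 'a \<Rightarrow> bool" where
  "support_point V N C x \<longleftrightarrow>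
     x \<in> C \<and> (\<exists>f\<in>dual_space V N. (\<exists>v\<in>V. f v \<noteq> 0) \<and> (\<forall>y\<in>C. f y \<le> f x))"

definition nonsupport_points ::
    "'a::real_vector set \<Rightarrow> ('a \<Rightarrow> real) \<Rightarrow> 'a set \<Rightarrow> 'a set" where
  "nonsupport_points V N C = {x \<in> C. \<not> support_point V N C x}"

definition linearly_isometric ::
    "'a::real_vector set \<Rightarrow> ('a \<Rightarrow> real) \<Rightarrow> 'b::real_vector set \<Rightarrow> ('b \<Rightarrow> real) \<Rightarrow> bool" where
  "linearly_isometric V N W M \<longleftrightarrow> subspace V \<and> subspace W \<and>
     (\<exists>T. linear_on V T \<and> bij_betw T V W \<and> (\<forall>x\<in>V. M (T x) = N x))"

definition cone_at :: "'a::real_vector set \<Rightarrow> 'a \<Rightarrow> 'a set" where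
  "cone_at C u = (\<Union>l\<in>{0<..}. (\<lambda>y. l *\<^sub>R (y - u)) ` C)"

definition cone_space :: "'a::real_vector set \<Rightarrow> 'a \<Rightarrow> 'a set" where
  "cone_space C u = cone_at C u \<inter> uminus ` cone_at C u"

definition order_interval :: "'a::{real_vector,ord} set \<Rightarrow> 'a \<Rightarrow> 'a set" where
  "order_interval V u = {x \<in> V. - u \<le> x \<and> x \<le> u}"

definition interval_norm :: "'a::{real_vector,ord} set \<Rightarrow> 'a \<Rightarrow> 'a \<Rightarrow> real" where
  "interval_norm V u x = Inf {l. 0 < l \<and> x \<in> (\<lambda>y. l *\<^sub>R y) ` order_interval V u}"

text \<open>The definitions below are meant for \<open>1 \<le> p \<le> \<infinity>\<close>.\<close>

definition lp_space :: "ereal \<Rightarrow> (nat \<Rightarrow> real) set" where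
  "lp_space p =
     (if p = \<infinity> then {x. bounded (range x)}
      else {x. summable (\<lambda>n. \<bar>x n\<bar> powr real_of_ereal p)})"

definition lp_norm :: "ereal \<Rightarrow> (nat \<Rightarrow> real) \<Rightarrow> real" where
  "lp_norm p x =
     (if p = \<infinity> then (SUP n. \<bar>x n\<bar>)
      else (\<Sum>n. \<bar>x n\<bar> powr real_of_ereal p) powr (1 / real_of_ereal p))"

definition lp_cone :: "ereal \<Rightarrow> (nat \<Rightarrow> real) set" where
  "lp_cone p = {x \<in> lp_space p. \<forall>n. 0 \<le> x n}"

end

theory Submission
  imports Defs
begin

text \<open>A coordinate functional that vanishes at a point of the cone supports the cone there, so
  all coordinates of \<open>u\<close> are positive. As \<open>\<ell>\<^sub>p\<close> is an order ideal in the space of all sequences,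
  \<open>X\<^sub>u\<close> consists of all sequences dominated by a multiple of \<open>u\<close>, and coordinatewise
  division by \<open>u\<close> is the isometry onto \<open>\<ell>\<^sub>\<infinity>\<close>.\<close>

section \<open>Membership and coordinate bounds in the sequence spaces\<close>

lemma mem_lp_space_infinity: "x \<in> lp_space \<infinity> \<longleftrightarrow> (\<exists>B. \<forall>n. \<bar>x n\<bar> \<le> B)"
  by (auto simp: lp_space_def bounded_iff)

lemma bdd_above_abs_lp_space_infinity:
  assumes "x \<in> lp_space \<infinity>"
  shows "bdd_above (range (\<lambda>n. \<bar>x n\<bar>))"
  using assms by (auto simp: mem_lp_space_infinity bdd_above_def)

lemma subspace_lp_space_infinity: "subspace (lp_space \<infinity>)"
proof (rule subspaceI)
  show "0 \<in> lp_space \<infinity>"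
    by (auto simp: mem_lp_space_infinity)
next
  fix x y :: "nat \<Rightarrow> real"
  assume "x \<in> lp_space \<infinity>" "y \<in> lp_space \<infinity>"
  then obtain A B where "\<And>n. \<bar>x n\<bar> \<le> A" "\<And>n. \<bar>y n\<bar> \<le> B"
    by (auto simp: mem_lp_space_infinity)
  then have "\<bar>(x + y) n\<bar> \<le> A + B" for n
    by (simp add: abs_triangle_ineq[THEN order_trans] add_mono)
  then show "x + y \<in> lp_space \<infinity>"
    unfolding mem_lp_space_infinity by blast
next
  fix c and x :: "nat \<Rightarrow> real"
  assume "x \<in> lp_space \<infinity>"
  then obtain A where "\<And>n. \<bar>x n\<bar> \<le> A"
    by (auto simp: mem_lp_space_infinity)
  then have "\<bar>(c *\<^sub>R x) n\<bar> \<le> \<bar>c\<bar> * A" for n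
    by (simp add: abs_mult mult_left_mono)
  then show "c *\<^sub>R x \<in> lp_space \<infinity>"
    unfolding mem_lp_space_infinity by blast
qed

text \<open>The order ideal property, by monotonicity of \<open>powr\<close> and comparison of
  series. It reduces the later membership questions to coordinatewise inequalities.\<close>

lemma lp_space_dominated:
  assumes "0 \<le> p" "u \<in> lp_space p" "\<And>n. \<bar>x n\<bar> \<le> l * \<bar>u n\<bar>"
  shows "x \<in> lp_space p"
proof (cases "p = \<infinity>")
  case True
  then obtain B where "\<And>n. \<bar>u n\<bar> \<le> B"
    using assms by (auto simp: mem_lp_space_infinity)
  \<comment> \<open>No sign is assumed for \<open>l\<close>; passing to \<open>\<bar>l\<bar>\<close>
    makes the factor nonnegative.\<close>
  moreover have "\<bar>x n\<bar> \<le> \<bar>l\<bar> * \<bar>u n\<bar>" for n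
    using assms(3)[of n] by (meson abs_ge_self abs_ge_zero mult_right_mono order_trans)
  ultimately have "\<bar>x n\<bar> \<le> \<bar>l\<bar> * B" for n
    by (meson abs_ge_zero mult_left_mono order_trans)
  then show ?thesis
    unfolding True mem_lp_space_infinity by blast
next
  case False
  define r where "r = real_of_ereal p"
  have r: "0 \<le> r"
    using assms(1) by (simp add: r_def real_of_ereal_pos)
  have "summable (\<lambda>n. \<bar>u n\<bar> powr r)"
    using assms(2) False by (simp add: lp_space_def r_def)
  then have "summable (\<lambda>n. \<bar>l\<bar> powr r * \<bar>u n\<bar> powr r)"
    by (rule summable_mult)
  moreover have "\<bar>x n\<bar> powr r \<le> \<bar>l\<bar> powr r * \<bar>u n\<bar> powr r" for n
  proof -
    have "\<bar>x n\<bar> \<le> \<bar>l\<bar> * \<bar>u n\<bar>"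
      using assms(3)[of n] by (meson abs_ge_self abs_ge_zero mult_right_mono order_trans)
    then show ?thesis
      using powr_mono2[OF r, of "\<bar>x n\<bar>" "\<bar>l\<bar> * \<bar>u n\<bar>"]
      by (simp add: powr_mult)
  qed
  ultimately have "summable (\<lambda>n. \<bar>x n\<bar> powr r)"
    by (elim summable_comparison_test'[where N = 0]) simp
  then show ?thesis
    using False by (simp add: lp_space_def r_def)
qed

lemma finite_support_in_lp_space:
  assumes "finite A" "\<And>n. n \<notin> A \<Longrightarrow> x n = 0"
  shows "x \<in> lp_space p"
proof (cases "p = \<infinity>")
  case True
  have "range x \<subseteq> insert 0 (x ` A)"
    using assms(2) by auto
  then show ?thesis
    using True assms(1) by (simp add: lp_space_def finite_imp_bounded finite_subset)
next
  case False
  then show ?thesis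
    \<comment> \<open>Since \<open>0 powr r = 0\<close> for every \<open>r\<close>, the series has
      only finitely many nonzero terms.\<close>
    using assms by (auto simp: lp_space_def intro!: summable_finite)
qed

text \<open>A single term of a series of nonnegative terms is at most its sum. Hence coordinate
  functionals are bounded, with constant 1, and lie in \<open>dual_space\<close>.\<close>

lemma abs_coordinate_le_lp_norm:
  assumes "1 \<le> p" "x \<in> lp_space p"
  shows "\<bar>x n\<bar> \<le> lp_norm p x"
proof (cases "p = \<infinity>")
  case True
  then show ?thesis
    using assms bdd_above_abs_lp_space_infinity by (auto simp: lp_norm_def intro: cSUP_upper)
next
  case False
  define r where "r = real_of_ereal p"
  have r: "1 \<le> r"
    using assms(1) False by (cases p) (auto simp: r_def)
  have "summable (\<lambda>n. \<bar>x n\<bar> powr r)"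
    using assms(2) False by (simp add: lp_space_def r_def)
  then have "(\<Sum>k\<in>{n}. \<bar>x k\<bar> powr r) \<le> (\<Sum>k. \<bar>x k\<bar> powr r)"
    by (intro sum_le_suminf) auto
  then have "(\<bar>x n\<bar> powr r) powr (1 / r) \<le> (\<Sum>k. \<bar>x k\<bar> powr r) powr (1 / r)"
    using r by (intro powr_mono2) auto
  then show ?thesis
    using r False by (simp add: powr_powr lp_norm_def r_def)
qed

section \<open>Strict positivity of nonsupport points\<close>

lemma nonsupport_point_lp_cone_pos:
  assumes "1 \<le> p" "u \<in> nonsupport_points (lp_space p) (lp_norm p) (lp_cone p)"
  shows "0 < u n"
proof (rule ccontr)
  assume "\<not> 0 < u n"
  moreover have u: "u \<in> lp_cone p"
    using assms(2) by (simp add: nonsupport_points_def)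
  ultimately have un: "u n = 0"
    by (auto simp: lp_cone_def not_less intro: antisym)
  \<comment> \<open>The sign turns the minimum 0 of the coordinate over the cone, attained at
    \<open>u\<close>, into the maximum that \<open>support_point\<close> asks for.\<close>
  define f where "f = (\<lambda>x :: nat \<Rightarrow> real. - x n)"
  have "\<forall>x\<in>lp_space p. \<bar>f x\<bar> \<le> 1 * lp_norm p x"
    using abs_coordinate_le_lp_norm[OF assms(1)] by (simp add: f_def)
  moreover have "linear_on (lp_space p) f"
    by (simp add: linear_on_def f_def)
  ultimately have "f \<in> dual_space (lp_space p) (lp_norm p)"
    unfolding dual_space_def by blast
  moreover have "indicator {n} \<in> lp_space p"
    by (rule finite_support_in_lp_space[of "{n}"]) auto
  then have "\<exists>v\<in>lp_space p. f v \<noteq> 0"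
    by (rule bexI[rotated]) (simp add: f_def)
  moreover have "\<forall>y\<in>lp_cone p. f y \<le> f u"
    using un by (simp add: f_def lp_cone_def)
  ultimately have "support_point (lp_space p) (lp_norm p) (lp_cone p) u"
    using u by (auto simp: support_point_def)
  then show False
    using assms(2) by (simp add: nonsupport_points_def)
qed

section \<open>The space \<open>X_u\<close> as the set of sequences dominated by a multiple of
  \<open>u\<close>\<close>

lemma cone_at_lp_cone_lower_bound:
  assumes "x \<in> cone_at (lp_cone p) u"
  obtains l where "0 < l" "\<And>n. - (l * u n) \<le> x n"
proof -
  from assms obtain l y where "0 < l" "y \<in> lp_cone p" "x = l *\<^sub>R (y - u)"
    by (auto simp: cone_at_def)
  then show thesis
    by (intro that[of l]) (auto simp: lp_cone_def right_diff_distrib)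
qed

lemma dominated_in_cone_at_lp_cone:
  assumes "0 \<le> p" "u \<in> lp_cone p" "0 < l" "\<And>n. \<bar>x n\<bar> \<le> l * u n"
  shows "x \<in> cone_at (lp_cone p) u"
proof -
  \<comment> \<open>The solution of \<open>x = l *\<^sub>R (y - u)\<close>. The lower bound on
    \<open>x\<close> makes \<open>y\<close> nonnegative, the upper bound gives
    \<open>y n \<le> 2 * u n\<close>, so \<open>y\<close> stays in the space.\<close>
  define y where "y = (\<lambda>n. x n / l + u n)"
  have x: "- u n \<le> x n / l" "x n / l \<le> u n" for n
    using assms(3) assms(4)[of n] by (auto simp: field_simps abs_le_iff)
  have y: "0 \<le> y n" "\<bar>y n\<bar> \<le> 2 * \<bar>u n\<bar>" for n
    using x[of n] by (auto simp: y_def)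
  have "y \<in> lp_space p"
    using assms(2) by (intro lp_space_dominated[OF assms(1) _ y(2)]) (simp add: lp_cone_def)
  then have "y \<in> lp_cone p"
    using y by (simp add: lp_cone_def)
  moreover have "x = l *\<^sub>R (y - u)"
    using assms(3) by (auto simp: y_def fun_eq_iff)
  ultimately show ?thesis
    using assms(3) by (auto simp: cone_at_def)
qed

lemma cone_space_lp_cone:
  assumes "0 \<le> p" "u \<in> lp_cone p"
  shows "cone_space (lp_cone p) u = {x. \<exists>l>0. \<forall>n. \<bar>x n\<bar> \<le> l * u n}"
proof (intro equalityI subsetI)
  fix x
  assume "x \<in> cone_space (lp_cone p) u"
  then have "x \<in> cone_at (lp_cone p) u" "- x \<in> cone_at (lp_cone p) u"
    by (auto simp: cone_space_def)
  then obtain l m where l: "0 < l" "\<And>n. - (l * u n) \<le> x n"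
    and m: "0 < m" "\<And>n. - (m * u n) \<le> (- x) n"
    by (metis cone_at_lp_cone_lower_bound)
  \<comment> \<open>The bounds from \<open>x\<close> and from \<open>- x\<close> are one-sided and
    have different factors; as \<open>u\<close> is nonnegative, \<open>l + m\<close> serves for
    both.\<close>
  have "\<bar>x n\<bar> \<le> (l + m) * u n" for n
  proof -
    have "0 \<le> l * u n" "0 \<le> m * u n"
      using assms(2) l(1) m(1) by (auto simp: lp_cone_def)
    then show ?thesis
      using l(2)[of n] m(2)[of n] by (auto simp: algebra_simps abs_le_iff)
  qed
  then show "x \<in> {x. \<exists>l>0. \<forall>n. \<bar>x n\<bar> \<le> l * u n}"
    using l(1) m(1) by (auto intro!: exI[of _ "l + m"])
next
  fix x
  assume "x \<in> {x. \<exists>l>0. \<forall>n. \<bar>x n\<bar> \<le> l * u n}"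
  then obtain l where "0 < l" "\<And>n. \<bar>x n\<bar> \<le> l * u n"
    by auto
  then have "x \<in> cone_at (lp_cone p) u" "- x \<in> cone_at (lp_cone p) u"
    by (auto intro!: dominated_in_cone_at_lp_cone[OF assms, of l])
  then show "x \<in> cone_space (lp_cone p) u"
    unfolding cone_space_def by (metis IntI add.inverse_inverse imageI)
qed

section \<open>The interval norm as a weighted supremum norm\<close>

lemma mem_scaled_order_interval_iff:
  assumes "0 \<le> p" "u \<in> lp_cone p" "0 < l"
  shows "x \<in> (\<lambda>y. l *\<^sub>R y) ` order_interval (lp_space p) u \<longleftrightarrow> (\<forall>n. \<bar>x n\<bar> \<le> l * u n)"
proof
  assume "x \<in> (\<lambda>y. l *\<^sub>R y) ` order_interval (lp_space p) u"
  then obtain y where x: "x = l *\<^sub>R y" and y: "\<And>n. - u n \<le> y n" "\<And>n. y n \<le> u n"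
    by (auto simp: order_interval_def le_fun_def)
  have "\<bar>y n\<bar> \<le> u n" for n
    using y[of n] by linarith
  then show "\<forall>n. \<bar>x n\<bar> \<le> l * u n"
    using assms(3) by (simp add: x abs_mult)
next
  assume *: "\<forall>n. \<bar>x n\<bar> \<le> l * u n"
  define y where "y = (\<lambda>n. x n / l)"
  have y: "- u n \<le> y n" "y n \<le> u n" for n
    using assms(3) *[rule_format, of n] by (auto simp: y_def field_simps abs_le_iff)
  then have "\<bar>y n\<bar> \<le> 1 * \<bar>u n\<bar>" for n
    by (simp add: abs_le_iff minus_le_iff order_trans[OF _ abs_ge_self])
  moreover have "u \<in> lp_space p"
    using assms(2) by (simp add: lp_cone_def)
  ultimately have "y \<in> lp_space p"
    by (rule lp_space_dominated[OF assms(1), rotated])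
  then have "y \<in> order_interval (lp_space p) u"
    using y by (simp add: order_interval_def le_fun_def)
  moreover have "x = l *\<^sub>R y"
    using assms(3) by (simp add: y_def fun_eq_iff)
  ultimately show "x \<in> (\<lambda>y. l *\<^sub>R y) ` order_interval (lp_space p) u"
    by blast
qed

text \<open>The condition \<open>0 < l\<close> in \<open>interval_norm\<close> excludes
  \<open>l = 0\<close>, so for \<open>s = 0\<close> the infimum is not attained and needs its own
  case.\<close>

lemma Inf_pos_upper_bounds:
  fixes s :: real
  assumes "0 \<le> s"
  shows "Inf {l. 0 < l \<and> s \<le> l} = s"
proof (cases "s = 0")
  case True
  then have "{l. 0 < l \<and> s \<le> l} = {0<..}"
    by auto
  then show ?thesis
    using True by simp
next
  case False
  then have "{l. 0 < l \<and> s \<le> l} = {s..}"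
    using assms by auto
  then show ?thesis
    by simp
qed

text \<open>Dividing by \<open>u n > 0\<close> shows that the admissible \<open>l\<close> are
  exactly the positive upper bounds of the quotients \<open>\<bar>x n / u n\<bar>\<close>, whose
  infimum is their supremum.\<close>

lemma interval_norm_eq_lp_norm_divide:
  assumes "0 \<le> p" "u \<in> lp_cone p" "\<And>n. 0 < u n" "(\<lambda>n. x n / u n) \<in> lp_space \<infinity>"
  shows "interval_norm (lp_space p) u x = lp_norm \<infinity> (\<lambda>n. x n / u n)"
proof -
  define s where "s = (SUP n. \<bar>x n / u n\<bar>)"
  \<comment> \<open>Boundedness makes the real-valued \<open>SUP\<close> a genuine least upper
    bound.\<close>
  note bdd = bdd_above_abs_lp_space_infinity[OF assms(4)]
  have "0 \<le> s"
    unfolding s_def using bdd by (auto intro: cSUP_upper2[where x = 0])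
  have "(\<forall>n. \<bar>x n\<bar> \<le> l * u n) \<longleftrightarrow> s \<le> l" for l
  proof -
    have "(\<forall>n. \<bar>x n\<bar> \<le> l * u n) \<longleftrightarrow> (\<forall>n. \<bar>x n / u n\<bar> \<le> l)"
      using assms(3) by (simp add: pos_divide_le_eq less_imp_le abs_of_pos)
    also have "\<dots> \<longleftrightarrow> s \<le> l"
      unfolding s_def using bdd by (subst cSUP_le_iff) auto
    finally show ?thesis .
  qed
  then have "{l. 0 < l \<and> x \<in> (\<lambda>y. l *\<^sub>R y) ` order_interval (lp_space p) u}
      = {l. 0 < l \<and> s \<le> l}"
    using mem_scaled_order_interval_iff[OF assms(1,2)] by auto
  then show ?thesis
    using Inf_pos_upper_bounds[OF \<open>0 \<le> s\<close>] by (simp add: interval_norm_def lp_norm_def s_def)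
qed

theorem corollary1:
  fixes p :: ereal and u :: "nat \<Rightarrow> real"
  assumes "1 \<le> p"
    and "u \<in> nonsupport_points (lp_space p) (lp_norm p) (lp_cone p)"
  shows "linearly_isometric (cone_space (lp_cone p) u) (interval_norm (lp_space p) u)
           (lp_space \<infinity>) (lp_norm \<infinity>)"
proof -
  have p: "0 \<le> p"
    using assms(1) by (rule order_trans[rotated]) simp
  have u: "u \<in> lp_cone p"
    using assms(2) by (simp add: nonsupport_points_def)
  have pos: "0 < u n" for n
    by (rule nonsupport_point_lp_cone_pos[OF assms])
  define T where "T = (\<lambda>(x :: nat \<Rightarrow> real) n. x n / u n)"
  have lin: "T (x + y) = T x + T y" "T (c *\<^sub>R x) = c *\<^sub>R T x" for x y c
    by (auto simp: T_def fun_eq_iff add_divide_distrib)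
  have T_inverse: "T (\<lambda>n. z n * u n) = z" "(\<lambda>n. T z n * u n) = z" for z
    using pos by (auto simp: T_def less_imp_neq[symmetric])
  have mem_iff: "x \<in> cone_space (lp_cone p) u \<longleftrightarrow> T x \<in> lp_space \<infinity>" for x
  proof -
    have "(\<forall>n. \<bar>x n\<bar> \<le> l * u n) \<longleftrightarrow> (\<forall>n. \<bar>T x n\<bar> \<le> l)" for l
      using pos by (simp add: T_def abs_divide pos_divide_le_eq less_imp_le abs_of_pos)
    then have "x \<in> cone_space (lp_cone p) u \<longleftrightarrow> (\<exists>l>0. \<forall>n. \<bar>T x n\<bar> \<le> l)"
      by (simp add: cone_space_lp_cone[OF p u])
    also have "\<dots> \<longleftrightarrow> T x \<in> lp_space \<infinity>"
      unfolding mem_lp_space_infinity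
      \<comment> \<open>The left side wants a positive bound; the maximum of any bound with 1 is
        one.\<close>
      by (meson less_max_iff_disj max.coboundedI2 zero_less_one)
    finally show ?thesis .
  qed
  have "linear T"
    by (intro linearI lin)
  \<comment> \<open>\<open>T\<close> is linear on all sequences, so \<open>X_u\<close> is a subspace
    as the preimage of one.\<close>
  moreover have "cone_space (lp_cone p) u = T -` lp_space \<infinity>"
    using mem_iff by auto
  ultimately have "subspace (cone_space (lp_cone p) u)"
    using linear_subspace_vimage subspace_lp_space_infinity by metis
  moreover have "linear_on (cone_space (lp_cone p) u) T"
    by (simp add: linear_on_def lin)
  moreover have "bij_betw T (cone_space (lp_cone p) u) (lp_space \<infinity>)"
    by (rule bij_betwI[where g = "\<lambda>z n. z n * u n"]) (auto simp: mem_iff T_inverse)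
  moreover have "lp_norm \<infinity> (T x) = interval_norm (lp_space p) u x"
    if "x \<in> cone_space (lp_cone p) u" for x
    using interval_norm_eq_lp_norm_divide[OF p u pos] that by (simp add: mem_iff T_def)
  ultimately show ?thesis
    unfolding linearly_isometric_def using subspace_lp_space_infinity by blast
qed

end
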